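(* Let $a < b$ be real numbers, let $f \in C^3([a,b])$ be real-valued, and let $\alpha \in (a,b)$ be a simple root of $f$ (that is, $f(\alpha) = 0$ and $f'(\alpha) \neq 0$). Suppose that $$f'(x) \neq 0, \quad f''(x) \neq 0, \quad L_f(x) \geq -\frac{9}{2}, \quad L_{f'}(x) \leq \frac{3}{2}$$ for all $x \in [a,b]$. For $x_0 \in [a,b]$ consider the sequence $\{x_n\}$ defined by $$x_{n+1} = x_n - C_*(L_f(x_n))\,\frac{f(x_n)}{f'(x_n)}, \qquad n = 0, 1, 2, \ldots.$$ Then, for any initial guess $x_0 \in [a,b]$ satisfying $f(x_0) f'(x_0) > 0$, the sequence $\{x_n\}$ is well-defined (all iterates lie in $[a,b]$), decreases monotonically (i.e. $x_{n+1} \leq x_n$ for all $n$) and converges to $\alpha$. If instead $x_0 \in [a,b]$ satisfies $f(x_0) f'(x_0) < 0$, then $\{x_n\}$ is well-defined (all iterates lie in $[a,b]$), increases monotonically (i.e. $x_{n+1} \geq x_n$ for all $n$) and converges to $\alpha$.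
   Context: For $x \in [a,b]$ with $f'(x) \neq 0$ and $f''(x) \neq 0$, put $$L_f(x) = \frac{f(x) f''(x)}{f'(x)^2}, \qquad L_{f'}(x) = \frac{f'(x) f^{(3)}(x)}{f''(x)^2}.$$ The correction function $C_*$ is defined for $L \in \mathbb{R}$ by $$C_*(L) = \frac{2}{1 + B(L)}, \qquad B(L) = \frac{1 - L + \frac{1}{2}L^2}{1 - L + L^2}\left(\sqrt{1 + L^2} - L\right).$$ *)

theory Defs
  imports "HOL-Analysis.Analysis"
begin

text \<open>
  Derivative relative to a set \<open>S\<close>; on \<open>S = {a..b}\<close> with \<open>a < b\<close> it is the
  one-sided derivative at the end points. It is meaningful only where \<open>f\<close> is
  differentiable within \<open>S\<close>.
\<close>

definition deriv_within :: "real set \<Rightarrow> (real \<Rightarrow> real) \<Rightarrow> real \<Rightarrow> real" where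
  "deriv_within S f = (\<lambda>x. vector_derivative f (at x within S))"

primrec C_k_on :: "nat \<Rightarrow> (real \<Rightarrow> real) \<Rightarrow> real set \<Rightarrow> bool" where
  "C_k_on 0 f S \<longleftrightarrow> continuous_on S f"
| "C_k_on (Suc k) f S \<longleftrightarrow> f differentiable_on S \<and> C_k_on k (deriv_within S f) S"

text \<open>
  \<open>L S f\<close> is the function \<open>L\<^sub>f\<close>; accordingly, \<open>L\<^sub>f\<^sub>'\<close> is \<open>L S (deriv_within S f)\<close>.
\<close>

definition L :: "real set \<Rightarrow> (real \<Rightarrow> real) \<Rightarrow> real \<Rightarrow> real" where
  "L S f x = f x * deriv_within S (deriv_within S f) x / (deriv_within S f x)\<^sup>2"

definition B :: "real \<Rightarrow> real" where
  "B l = (1 - l + 1/2 * l\<^sup>2) / (1 - l + l\<^sup>2) * (sqrt (1 + l\<^sup>2) - l)"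

definition C_star :: "real \<Rightarrow> real" where
  "C_star l = 2 / (1 + B l)"

text \<open>
  Total as a HOL function: an iterate outside \<open>S\<close> would be followed by values depending
  on how \<open>f\<close> happens to be extended beyond \<open>S\<close>. Well-definedness of the sequence is
  therefore the assertion that every iterate lies in \<open>S\<close>.
\<close>

primrec iter_seq :: "real set \<Rightarrow> (real \<Rightarrow> real) \<Rightarrow> real \<Rightarrow> nat \<Rightarrow> real" where
  "iter_seq S f x0 0 = x0"
| "iter_seq S f x0 (Suc n) =
     (let x = iter_seq S f x0 n in x - C_star (L S f x) * (f x / deriv_within S f x))"

end

theory Submission
  imports Defs
begin

text \<open>
  The inequality \<open>L\<^sub>f\<^sub>' \<le> 3/2\<close> says that the Schwarzian derivative of \<open>f\<close> is nonpositive, so that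
  \<open>g = f / sqrt f'\<close> (with \<open>f' > 0\<close>) is convex to the right of \<open>\<alpha>\<close> and concave to the left of it.
  Newton's method for \<open>g\<close> is Halley's method for \<open>f\<close>, which has correction factor
  \<open>2 / (2 - L)\<close>; hence a Halley step never jumps over \<open>\<alpha>\<close>. Since \<open>1 - L \<le> B L\<close>, the present method
  makes smaller steps than Halley's in the same direction, so it is monotone as well. The lower bound
  on \<open>L\<^sub>f\<close> keeps \<open>C_star\<close> away from \<open>0\<close>, which forces the limit of the iterates to be a root.
\<close>

section \<open>Elementary bounds for the correction function\<close>

lemma sqrt_1_plus_square_gt: "(l::real) < sqrt (1 + l\<^sup>2)"
  by (rule real_less_rsqrt) simp

lemma B_denominator_pos: "(0::real) < 1 - l + l\<^sup>2"
proof -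
  have "1 - l + l\<^sup>2 = (l - 1/2)\<^sup>2 + 3/4"
    by (simp add: power2_eq_square algebra_simps)
  then show ?thesis
    by (metis add_nonneg_pos zero_le_power2 zero_less_divide_iff zero_less_numeral)
qed

lemma B_numerator_pos: "(0::real) < 1 - l + 1/2 * l\<^sup>2"
proof -
  have "1 - l + 1/2 * l\<^sup>2 = ((l - 1)\<^sup>2 + 1) / 2"
    by (simp add: power2_eq_square field_simps)
  also have "\<dots> > 0"
    by (intro divide_pos_pos add_nonneg_pos) auto
  finally show ?thesis .
qed

lemma B_pos: "0 < B l"
  unfolding B_def
  using B_denominator_pos[of l] B_numerator_pos[of l] sqrt_1_plus_square_gt[of l] by simp

text \<open>After clearing the positive denominator and isolating the root, both sides can be
  squared; the squares then differ by exactly \<open>l ^ 4 / 4\<close>.\<close>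

lemma B_ge: "1 - l \<le> B l"
proof -
  define p where "p = 1 - l + 1/2 * l\<^sup>2"
  define q where "q = 1 - l + l\<^sup>2"
  have p: "0 < p" and q: "0 < q"
    unfolding p_def q_def by (rule B_numerator_pos, rule B_denominator_pos)
  have "(p * sqrt (1 + l\<^sup>2))\<^sup>2 = p\<^sup>2 * (1 + l\<^sup>2)"
    by (simp add: power_mult_distrib)
  also have "\<dots> = ((1 - l) * q + l * p)\<^sup>2 + l ^ 4 / 4"
    unfolding p_def q_def by (simp add: field_simps power2_eq_square power4_eq_xxxx)
  finally have "((1 - l) * q + l * p)\<^sup>2 \<le> (p * sqrt (1 + l\<^sup>2))\<^sup>2"
    by simp
  moreover have "0 \<le> p * sqrt (1 + l\<^sup>2)"
    using p by simp
  ultimately have "(1 - l) * q + l * p \<le> p * sqrt (1 + l\<^sup>2)"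
    by (rule power2_le_imp_le)
  then have "(1 - l) * q \<le> p * (sqrt (1 + l\<^sup>2) - l)"
    by (simp add: algebra_simps)
  then have "1 - l \<le> p * (sqrt (1 + l\<^sup>2) - l) / q"
    using q by (simp add: pos_le_divide_eq)
  then show ?thesis
    unfolding B_def p_def q_def by simp
qed

lemma B_le: "B l \<le> 1 + \<bar>l\<bar> - l"
proof -
  have "(1 - l + 1/2 * l\<^sup>2) / (1 - l + l\<^sup>2) \<le> 1"
    using B_denominator_pos[of l] by simp
  then have "B l \<le> 1 * (sqrt (1 + l\<^sup>2) - l)"
    unfolding B_def using sqrt_1_plus_square_gt[of l] by (intro mult_right_mono) auto
  also have "sqrt (1 + l\<^sup>2) \<le> 1 + \<bar>l\<bar>"
    using sqrt_add_le_add_sqrt[of 1 "l\<^sup>2"] by simp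
  finally show ?thesis by simp
qed

lemma C_star_pos: "0 < C_star l"
  unfolding C_star_def using B_pos[of l] by simp

text \<open>Comparison with Halley's correction factor; \<open>l < 2\<close> makes the latter
  positive, so that \<open>B_ge\<close> can be inverted.\<close>

lemma C_star_le_Halley: "l < 2 \<Longrightarrow> C_star l \<le> 2 / (2 - l)"
  unfolding C_star_def using B_ge[of l] by (intro divide_left_mono) (auto intro!: mult_pos_pos)

lemma C_star_ge:
  assumes "- (9/2) \<le> l"
  shows "2/11 \<le> C_star l"
proof -
  \<comment> \<open>For negative \<open>l\<close> the bound of \<open>B_le\<close> is
    \<open>1 - 2 * l\<close>, hence at most 10 here, and \<open>2/11 = 2 / (1 + 10)\<close>.\<close>
  have "B l \<le> 10"
    using B_le[of l] assms by linarith
  then show ?thesis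
    unfolding C_star_def using B_pos[of l] by (simp add: field_simps)
qed

section \<open>Convexity of \<open>f / sqrt f'\<close> and the Halley bound\<close>

text \<open>
  The tangent to \<open>g = f / sqrt f'\<close> at \<open>t\<close>, evaluated at \<open>c\<close>, has \<open>t\<close>-derivative \<open>(c - t) * g'' t\<close>,
  and \<open>g''\<close> is \<open>- g / 2\<close> times the Schwarzian derivative of \<open>f\<close>.
\<close>

lemma tangent_value_has_derivative:
  fixes f f1 f2 f3 :: "real \<Rightarrow> real" and c :: real
  assumes f: "(f has_real_derivative f1 t) (at t within S)"
    and f1: "(f1 has_real_derivative f2 t) (at t within S)"
    and f2: "(f2 has_real_derivative f3 t) (at t within S)"
    and pos: "0 < f1 t"
  defines "q \<equiv> \<lambda>t. inverse (sqrt (f1 t))"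
  shows "((\<lambda>t. f t * q t + (c - t) * (f1 t * q t - f t * f2 t * q t ^ 3 / 2))
      has_real_derivative
        (c - t) * f t * (3 * (f2 t)\<^sup>2 - 2 * (f1 t * f3 t)) * q t ^ 5 / 4) (at t within S)"
proof -
  \<comment> \<open>The only relation between \<open>q t\<close> and \<open>f1 t\<close> that the
    closing polynomial identity needs.\<close>
  have q2: "f1 t * q t ^ 2 = 1"
    unfolding q_def using pos by (simp add: power_inverse)
  have q: "(q has_real_derivative - (f2 t * q t ^ 3 / 2)) (at t within S)"
    unfolding q_def using pos
    by (auto intro!: derivative_eq_intros f1 simp: field_simps eval_nat_numeral)
  have "((\<lambda>t. f t * q t + (c - t) * (f1 t * q t - f t * f2 t * q t ^ 3 / 2))
      has_real_derivative
        f1 t * q t - f t * (f2 t * q t ^ 3 / 2) - (f1 t * q t - f t * f2 t * q t ^ 3 / 2)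
        + (c - t) * (f2 t * q t - f1 t * (f2 t * q t ^ 3 / 2)
          - ((f1 t * f2 t + f t * f3 t) * q t ^ 3
            - f t * f2 t * (3 * q t ^ 2 * (f2 t * q t ^ 3 / 2))) / 2)) (at t within S)"
    by (rule derivative_eq_intros f f1 f2 q refl | simp)+ (simp add: field_simps)
  also have "f1 t * q t - f t * (f2 t * q t ^ 3 / 2) - (f1 t * q t - f t * f2 t * q t ^ 3 / 2)
        + (c - t) * (f2 t * q t - f1 t * (f2 t * q t ^ 3 / 2)
          - ((f1 t * f2 t + f t * f3 t) * q t ^ 3
            - f t * f2 t * (3 * q t ^ 2 * (f2 t * q t ^ 3 / 2))) / 2) =
      (c - t) * f t * (3 * (f2 t)\<^sup>2 - 2 * (f1 t * f3 t)) * q t ^ 5 / 4"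
    using q2 by algebra
  finally show ?thesis .
qed

text \<open>Serves derivatives known only relative to a larger set, one-sided at its end points. A
  point in the closed interval suffices, since only the sign of \<open>f'\<close> matters
  later.\<close>

lemma mean_value_within:
  fixes f :: "real \<Rightarrow> real"
  assumes "x \<le> y"
    and "\<And>t. t \<in> {x..y} \<Longrightarrow> (f has_real_derivative f' t) (at t within S)"
    and "{x..y} \<subseteq> S"
  shows "\<exists>t\<in>{x..y}. f y - f x = f' t * (y - x)"
proof -
  have "(f has_derivative (\<lambda>h. f' t * h)) (at t within {x..y})" if "x \<le> t" "t \<le> y" for t
    using has_field_derivative_subset[OF assms(2) assms(3)] that
    unfolding has_field_derivative_def by auto
  from mvt_very_simple[OF assms(1) this] show ?thesis
    by blast
qed

text \<open>The tangent value \<open>k\<close> at \<alpha> is antitone and vanishes at \<alpha>, so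
  the sign of \<open>k x\<close> is known on each side. The bound is kept in product form because
  \<open>1 - L/2\<close> is not yet known to be positive.\<close>

lemma Halley_step_bound_increasing:
  fixes f f1 f2 f3 :: "real \<Rightarrow> real"
  assumes f: "\<And>t. t \<in> {a..b} \<Longrightarrow> (f has_real_derivative f1 t) (at t within {a..b})"
    and f1: "\<And>t. t \<in> {a..b} \<Longrightarrow> (f1 has_real_derivative f2 t) (at t within {a..b})"
    and f2: "\<And>t. t \<in> {a..b} \<Longrightarrow> (f2 has_real_derivative f3 t) (at t within {a..b})"
    and pos: "\<And>t. t \<in> {a..b} \<Longrightarrow> 0 < f1 t"
    and schwarzian: "\<And>t. t \<in> {a..b} \<Longrightarrow> 2 * (f1 t * f3 t) \<le> 3 * (f2 t)\<^sup>2"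
    and \<alpha>: "\<alpha> \<in> {a..b}" "f \<alpha> = 0" and x: "x \<in> {a..b}"
  shows "(\<alpha> < x \<longrightarrow> 0 < f x / f1 x \<and> f x / f1 x \<le> (1 - f x * f2 x / (f1 x)\<^sup>2 / 2) * (x - \<alpha>)) \<and>
    (x < \<alpha> \<longrightarrow> f x / f1 x < 0 \<and> (1 - f x * f2 x / (f1 x)\<^sup>2 / 2) * (x - \<alpha>) \<le> f x / f1 x)"
proof -
  have f_less: "f s < f t" if "s \<in> {a..b}" "t \<in> {a..b}" "s < t" for s t
  proof -
    have "\<exists>r\<in>{s..t}. f t - f s = f1 r * (t - s)"
      by (rule mean_value_within[where S = "{a..b}"]) (use that f in auto)
    then obtain r where "r \<in> {s..t}" and r: "f t - f s = f1 r * (t - s)"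
      by blast
    then have "0 < f1 r"
      using pos[of r] that by auto
    then have "0 < f1 r * (t - s)"
      using that by simp
    then show ?thesis
      using r by simp
  qed
  define q where "q = (\<lambda>t. inverse (sqrt (f1 t)))"
  define k where "k = (\<lambda>t. f t * q t + (\<alpha> - t) * (f1 t * q t - f t * f2 t * q t ^ 3 / 2))"
  define k' where "k' = (\<lambda>t. (\<alpha> - t) * f t * (3 * (f2 t)\<^sup>2 - 2 * (f1 t * f3 t)) * q t ^ 5 / 4)"
  have q: "0 < q t" if "t \<in> {a..b}" for t
    unfolding q_def using pos[OF that] by simp
  have k: "(k has_real_derivative k' t) (at t within {a..b})" if "t \<in> {a..b}" for t
    unfolding k_def k'_def q_def
    using f[OF that] f1[OF that] f2[OF that] pos[OF that] by (rule tangent_value_has_derivative)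
  have k'_nonpos: "k' t \<le> 0" if "t \<in> {a..b}" for t
  proof -
    \<comment> \<open>As \<open>f\<close> increases through its root \<alpha>, \<open>f t\<close>
      has the sign of \<open>t - \<alpha>\<close>; the remaining factors of \<open>k' t\<close> are
      nonnegative.\<close>
    have "(\<alpha> - t) * f t \<le> 0"
      using f_less[OF \<alpha>(1) that] f_less[OF that \<alpha>(1)] \<alpha>(2)
      by (cases \<alpha> t rule: linorder_cases) (auto simp: mult_le_0_iff)
    then show ?thesis
      unfolding k'_def using q[OF that] schwarzian[OF that]
      by (intro divide_nonpos_nonneg mult_nonpos_nonneg[of _ "q t ^ 5"]
          mult_nonpos_nonneg[of "(\<alpha> - t) * f t"]) auto
  qed
  have k_antimono: "k t \<le> k s" if "s \<in> {a..b}" "t \<in> {a..b}" "s \<le> t" for s t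
  proof -
    have "\<exists>r\<in>{s..t}. k t - k s = k' r * (t - s)"
      by (rule mean_value_within[where S = "{a..b}"]) (use that k in auto)
    then obtain r where "r \<in> {s..t}" and r: "k t - k s = k' r * (t - s)"
      by blast
    then have "k' r \<le> 0"
      using k'_nonpos[of r] that by auto
    then have "k' r * (t - s) \<le> 0"
      using that by (simp add: mult_le_0_iff)
    then show ?thesis
      using r by simp
  qed
  have k\<alpha>: "k \<alpha> = 0"
    unfolding k_def using \<alpha> by simp
  define p where "p = f1 x * q x"
  have p: "0 < p"
    unfolding p_def using pos[OF x] q[OF x] by simp
  have q2: "f1 x * q x ^ 2 = 1"
    unfolding q_def using pos[OF x] by (simp add: power_inverse)
  \<comment> \<open>Factoring out \<open>p = sqrt (f1 x) > 0\<close> turns the sign of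
    \<open>k x\<close> into the desired inequality for the Newton step.\<close>
  have kx: "k x = p * (f x / f1 x - (1 - f x * f2 x / (f1 x)\<^sup>2 / 2) * (x - \<alpha>))"
  proof -
    have "inverse (f1 x) = q x ^ 2"
      using q2 by (rule inverse_unique)
    then have "f x / f1 x = f x * q x ^ 2" "f x * f2 x / (f1 x)\<^sup>2 = f x * f2 x * (q x ^ 2)\<^sup>2"
      by (simp_all add: divide_inverse flip: power_inverse)
    then show ?thesis
      using q2 unfolding k_def p_def by algebra
  qed
  show ?thesis
  proof (intro conjI impI)
    assume "\<alpha> < x"
    then show "0 < f x / f1 x"
      using f_less[OF \<alpha>(1) x] \<alpha>(2) pos[OF x] by simp
    show "f x / f1 x \<le> (1 - f x * f2 x / (f1 x)\<^sup>2 / 2) * (x - \<alpha>)"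
      using k_antimono[OF \<alpha>(1) x] k\<alpha> kx p \<open>\<alpha> < x\<close> by (simp add: mult_le_0_iff)
  next
    assume "x < \<alpha>"
    then show "f x / f1 x < 0"
      using f_less[OF x \<alpha>(1)] \<alpha>(2) pos[OF x] by (simp add: divide_neg_pos)
    show "(1 - f x * f2 x / (f1 x)\<^sup>2 / 2) * (x - \<alpha>) \<le> f x / f1 x"
      using k_antimono[OF x \<alpha>(1)] k\<alpha> kx p \<open>x < \<alpha>\<close> by (simp add: zero_le_mult_iff)
  qed
qed

lemma continuous_nonzero_same_sign:
  fixes f :: "real \<Rightarrow> real"
  assumes "continuous_on {a..b} f" and "\<And>t. t \<in> {a..b} \<Longrightarrow> f t \<noteq> 0"
  shows "(\<forall>t\<in>{a..b}. 0 < f t) \<or> (\<forall>t\<in>{a..b}. f t < 0)"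
proof (rule ccontr)
  assume "\<not> ?thesis"
  then obtain s t where st: "s \<in> {a..b}" "t \<in> {a..b}" "f s \<le> 0" "0 \<le> f t"
    by (meson not_le)
  have "is_interval (f ` {a..b})"
    using connected_continuous_image[OF assms(1)] by (simp add: is_interval_connected_1)
  then have "0 \<in> f ` {a..b}"
    using st unfolding is_interval_1 by blast
  then show False
    using assms(2) by fastforce
qed

text \<open>By continuity \<open>f1\<close> has constant sign. Replacing \<open>f\<close> by
  \<open>-f\<close> changes neither the quotients in the conclusion nor the Schwarzian condition, so
  positive \<open>f1\<close> is enough.\<close>

lemma Halley_step_bound:
  fixes f f1 f2 f3 :: "real \<Rightarrow> real"
  assumes f: "\<And>t. t \<in> {a..b} \<Longrightarrow> (f has_real_derivative f1 t) (at t within {a..b})"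
    and f1: "\<And>t. t \<in> {a..b} \<Longrightarrow> (f1 has_real_derivative f2 t) (at t within {a..b})"
    and f2: "\<And>t. t \<in> {a..b} \<Longrightarrow> (f2 has_real_derivative f3 t) (at t within {a..b})"
    and nz: "\<And>t. t \<in> {a..b} \<Longrightarrow> f1 t \<noteq> 0"
    and schwarzian: "\<And>t. t \<in> {a..b} \<Longrightarrow> 2 * (f1 t * f3 t) \<le> 3 * (f2 t)\<^sup>2"
    and \<alpha>: "\<alpha> \<in> {a..b}" "f \<alpha> = 0" and x: "x \<in> {a..b}"
  shows "(\<alpha> < x \<longrightarrow> 0 < f x / f1 x \<and> f x / f1 x \<le> (1 - f x * f2 x / (f1 x)\<^sup>2 / 2) * (x - \<alpha>)) \<and>
    (x < \<alpha> \<longrightarrow> f x / f1 x < 0 \<and> (1 - f x * f2 x / (f1 x)\<^sup>2 / 2) * (x - \<alpha>) \<le> f x / f1 x)"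
proof -
  have "continuous_on {a..b} f1"
    using f1 by (rule DERIV_continuous_on)
  from continuous_nonzero_same_sign[OF this nz] show ?thesis
  proof
    assume "\<forall>t\<in>{a..b}. 0 < f1 t"
    then show ?thesis
      using Halley_step_bound_increasing[of a b f f1 f2 f3 \<alpha> x] f f1 f2 schwarzian \<alpha> x by blast
  next
    assume "\<forall>t\<in>{a..b}. f1 t < 0"
    then show ?thesis
      using Halley_step_bound_increasing[of a b "\<lambda>t. - f t" "\<lambda>t. - f1 t" "\<lambda>t. - f2 t" "\<lambda>t. - f3 t" \<alpha> x]
        DERIV_minus[OF f] DERIV_minus[OF f1] DERIV_minus[OF f2] schwarzian \<alpha> x by simp
  qed
qed

section \<open>From the Halley bound to monotone, convergent iterations\<close>

lemma C_star_step_bound: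
  assumes right: "\<alpha> < x \<longrightarrow> 0 < u \<and> u \<le> (1 - l / 2) * (x - \<alpha>)"
    and left: "x < \<alpha> \<longrightarrow> u < 0 \<and> (1 - l / 2) * (x - \<alpha>) \<le> u"
    and root: "x = \<alpha> \<longrightarrow> u = 0"
  shows "(\<alpha> \<le> x \<longrightarrow> 0 \<le> C_star l * u \<and> C_star l * u \<le> x - \<alpha>) \<and>
    (x \<le> \<alpha> \<longrightarrow> C_star l * u \<le> 0 \<and> x - \<alpha> \<le> C_star l * u)"
proof -
  have bound: "0 \<le> C_star l * v \<and> C_star l * v \<le> d"
    if "0 < d" "0 < v" "v \<le> (1 - l / 2) * d" for v d
  proof -
    have "0 < (1 - l / 2) * d"
      using that by linarith
    \<comment> \<open>Forced by the bound itself: a positive Newton step lies below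
      \<open>(1 - l / 2) * d\<close> with \<open>d > 0\<close>. The Halley factor then cancels
      \<open>1 - l / 2\<close> exactly.\<close>
    then have l: "l < 2"
      using that(1) by (simp add: zero_less_mult_iff)
    have "C_star l * v \<le> 2 / (2 - l) * ((1 - l / 2) * d)"
      using C_star_le_Halley[OF l] that l by (intro mult_mono) auto
    also have "\<dots> = d"
      using l by (simp add: field_simps)
    finally show ?thesis
      using C_star_pos[of l] that by simp
  qed
  have flip: "(1 - l / 2) * (\<alpha> - x) = - ((1 - l / 2) * (x - \<alpha>))"
    by (metis minus_diff_eq mult_minus_right)
  show ?thesis
    using bound[of "x - \<alpha>" u] bound[of "\<alpha> - x" "- u"] right left root unfolding flip
    by (cases \<alpha> x rule: linorder_cases) auto
qed

text \<open>Successive differences tend to 0, and since \<open>c n\<close> stays above \<delta> so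
  does \<open>u (X n)\<close>; continuity makes the limit a zero of \<open>u\<close>. No convergence
  of \<open>c\<close> is required.\<close>

lemma damped_iteration_limit:
  fixes X c :: "nat \<Rightarrow> real" and u :: "real \<Rightarrow> real"
  assumes "compact S" and X: "\<And>n. X n \<in> S" and lim: "X \<longlonglongrightarrow> l"
    and step: "\<And>n. X (Suc n) = X n - c n * u (X n)"
    and "0 < \<delta>" and c: "\<And>n. \<delta> \<le> c n"
    and u: "continuous_on S u" and root: "\<And>x. x \<in> S \<Longrightarrow> u x = 0 \<Longrightarrow> x = \<alpha>"
  shows "l = \<alpha>"
proof -
  have l: "l \<in> S"
    using closed_sequentially[OF compact_imp_closed[OF \<open>compact S\<close>]] X lim by blast
  have "(\<lambda>n. X n - X (Suc n)) \<longlonglongrightarrow> l - l"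
    by (intro tendsto_diff lim LIMSEQ_Suc)
  then have "(\<lambda>n. (X n - X (Suc n)) / \<delta>) \<longlonglongrightarrow> 0"
    using tendsto_divide_zero by fastforce
  moreover have "norm (u (X n)) \<le> norm ((X n - X (Suc n)) / \<delta>) * 1" for n
  proof -
    have "\<delta> * \<bar>u (X n)\<bar> \<le> \<bar>c n\<bar> * \<bar>u (X n)\<bar>"
      using c[of n] by (intro mult_right_mono) auto
    then show ?thesis
      using \<open>0 < \<delta>\<close> step[of n] by (simp add: field_simps abs_mult)
  qed
  ultimately have "(\<lambda>n. u (X n)) \<longlonglongrightarrow> 0"
    by (rule tendsto_0_le[OF _ always_eventually[OF allI]])
  moreover have "(\<lambda>n. u (X n)) \<longlonglongrightarrow> u l"
    using continuous_on_tendsto_compose[OF u lim l] X by simp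
  ultimately show ?thesis
    using root[OF l] LIMSEQ_unique by blast
qed

section \<open>One-sided derivatives at the end points, and assembly of the result\<close>

lemma deriv_within_has_derivative:
  assumes "f differentiable_on S" and "x \<in> S"
  shows "(f has_real_derivative deriv_within S f x) (at x within S)"
proof -
  have "f differentiable at x within S"
    using assms by (simp add: differentiable_on_def)
  then show ?thesis
    unfolding deriv_within_def has_real_derivative_iff_has_vector_derivative
    by (simp flip: vector_derivative_works)
qed

theorem theorem3p6:
  fixes a b \<alpha> :: real and f :: "real \<Rightarrow> real"
  assumes "a < b"
    and "C_k_on 3 f {a..b}"
    and "\<alpha> \<in> {a<..<b}"
    and "f \<alpha> = 0" and "deriv_within {a..b} f \<alpha> \<noteq> 0"
    and "\<And>x. x \<in> {a..b} \<Longrightarrow> deriv_within {a..b} f x \<noteq> 0"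
    and "\<And>x. x \<in> {a..b} \<Longrightarrow> deriv_within {a..b} (deriv_within {a..b} f) x \<noteq> 0"
    and "\<And>x. x \<in> {a..b} \<Longrightarrow> L {a..b} f x \<ge> - (9/2)"
    and "\<And>x. x \<in> {a..b} \<Longrightarrow> L {a..b} (deriv_within {a..b} f) x \<le> 3/2"
  shows
    "\<forall>x0\<in>{a..b}.
       (f x0 * deriv_within {a..b} f x0 > 0 \<longrightarrow>
          (\<forall>n. iter_seq {a..b} f x0 n \<in> {a..b}) \<and>
          (\<forall>n. iter_seq {a..b} f x0 (Suc n) \<le> iter_seq {a..b} f x0 n) \<and>
          iter_seq {a..b} f x0 \<longlonglongrightarrow> \<alpha>) \<and>
       (f x0 * deriv_within {a..b} f x0 < 0 \<longrightarrow>
          (\<forall>n. iter_seq {a..b} f x0 n \<in> {a..b}) \<and>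
          (\<forall>n. iter_seq {a..b} f x0 (Suc n) \<ge> iter_seq {a..b} f x0 n) \<and>
          iter_seq {a..b} f x0 \<longlonglongrightarrow> \<alpha>)"
proof -
  define S where "S = {a..b}"
  define f1 where "f1 = deriv_within S f"
  define f2 where "f2 = deriv_within S f1"
  define f3 where "f3 = deriv_within S f2"
  define u where "u = (\<lambda>x. f x / f1 x)"
  note defs = S_def f1_def f2_def f3_def
  have "f differentiable_on S" "f1 differentiable_on S" "f2 differentiable_on S"
    using assms(2) by (simp_all add: defs numeral_3_eq_3)
  then have f: "\<And>t. t \<in> S \<Longrightarrow> (f has_real_derivative f1 t) (at t within S)"
    and f1: "\<And>t. t \<in> S \<Longrightarrow> (f1 has_real_derivative f2 t) (at t within S)"
    and f2: "\<And>t. t \<in> S \<Longrightarrow> (f2 has_real_derivative f3 t) (at t within S)"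
    unfolding f1_def f2_def f3_def by (simp_all add: deriv_within_has_derivative)
  have nz: "f1 t \<noteq> 0" if "t \<in> S" for t
    using assms(6) that by (simp add: defs)
  have L_eq: "L S f t = f t * f2 t / (f1 t)\<^sup>2" for t
    unfolding L_def f2_def f1_def ..
  \<comment> \<open>The bound on \<open>L S f1\<close> multiplied out, which is legitimate because
    \<open>f2\<close> has no zero on \<open>S\<close>.\<close>
  have schwarzian: "2 * (f1 t * f3 t) \<le> 3 * (f2 t)\<^sup>2" if "t \<in> S" for t
    using assms(7,9)[of t] that by (simp add: L_def defs divide_le_eq)
  have \<alpha>: "\<alpha> \<in> S"
    using assms(3) by (simp add: S_def)
  have Halley: "(\<alpha> < x \<longrightarrow> 0 < u x \<and> u x \<le> (1 - L S f x / 2) * (x - \<alpha>)) \<and>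
      (x < \<alpha> \<longrightarrow> u x < 0 \<and> (1 - L S f x / 2) * (x - \<alpha>) \<le> u x)" if "x \<in> S" for x
    unfolding u_def L_eq
    using f f1 f2 nz schwarzian \<alpha> assms(4) that unfolding S_def
    by (rule Halley_step_bound)
  have u\<alpha>: "u \<alpha> = 0"
    by (simp add: u_def assms(4))
  have u_root: "x = \<alpha>" if "x \<in> S" "u x = 0" for x
    using Halley[OF that(1)] that(2) by (cases x \<alpha> rule: linorder_cases) auto
  have u_cont: "continuous_on S u"
    unfolding u_def using nz
    by (intro continuous_on_divide DERIV_continuous_on[OF f] DERIV_continuous_on[OF f1]) auto
  have step_bound: "(\<alpha> \<le> x \<longrightarrow> 0 \<le> C_star (L S f x) * u x \<and> C_star (L S f x) * u x \<le> x - \<alpha>) \<and>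
      (x \<le> \<alpha> \<longrightarrow> C_star (L S f x) * u x \<le> 0 \<and> x - \<alpha> \<le> C_star (L S f x) * u x)"
    if "x \<in> S" for x
    using Halley[OF that] u\<alpha> by (intro C_star_step_bound) auto
  \<comment> \<open>True for every \<open>x\<close>: where \<open>f1 x = 0\<close>, product and
    quotient are both 0. It translates the condition on the initial guess into its position relative
    to \<alpha>.\<close>
  have sign: "(0 < f x * f1 x \<longleftrightarrow> 0 < u x) \<and> (f x * f1 x < 0 \<longleftrightarrow> u x < 0)" for x
    by (auto simp: u_def zero_less_mult_iff zero_less_divide_iff mult_less_0_iff divide_less_0_iff)
  have right_or_left: "(0 < u x \<longrightarrow> \<alpha> \<le> x) \<and> (u x < 0 \<longrightarrow> x \<le> \<alpha>)" if "x \<in> S" for x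
    using Halley[OF that] u\<alpha> by (cases x \<alpha> rule: linorder_cases) auto
  have step: "iter_seq S f x0 (Suc n) =
      iter_seq S f x0 n - C_star (L S f (iter_seq S f x0 n)) * u (iter_seq S f x0 n)" for x0 n
    by (simp add: Let_def u_def f1_def)
  \<comment> \<open>Stated for \<open>monoseq\<close>, so that the decreasing and the increasing
    case share it.\<close>
  have limit: "iter_seq S f x0 \<longlonglongrightarrow> \<alpha>"
    if in_S: "\<And>n. iter_seq S f x0 n \<in> S" and mono: "monoseq (iter_seq S f x0)" for x0
  proof -
    have "Bseq (iter_seq S f x0)"
      unfolding Bseq_eq_bounded
      by (rule bounded_subset[OF bounded_closed_interval[of a b]]) (use in_S in \<open>auto simp: S_def\<close>)
    then obtain l where l: "iter_seq S f x0 \<longlonglongrightarrow> l"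
      using Bseq_monoseq_convergent[OF _ mono] unfolding convergent_def by blast
    have "2/11 \<le> C_star (L S f (iter_seq S f x0 n))" for n
      using C_star_ge assms(8) in_S unfolding S_def by blast
    then have "l = \<alpha>"
      using damped_iteration_limit[of S "iter_seq S f x0" l "\<lambda>n. C_star (L S f (iter_seq S f x0 n))" u
          "2/11" \<alpha>] in_S l step u_cont u_root unfolding S_def by simp
    with l show ?thesis
      by simp
  qed
  have right: "(\<forall>n. iter_seq S f x0 n \<in> S) \<and>
      (\<forall>n. iter_seq S f x0 (Suc n) \<le> iter_seq S f x0 n) \<and> iter_seq S f x0 \<longlonglongrightarrow> \<alpha>"
    if "x0 \<in> S" "\<alpha> \<le> x0" for x0
  proof -
    \<comment> \<open>Carrying the side of \<alpha> through the induction confines the next iterate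
      between \<alpha> and the current one, hence to \<open>S\<close>.\<close>
    have inv: "iter_seq S f x0 n \<in> S \<and> \<alpha> \<le> iter_seq S f x0 n" for n
    proof (induction n)
      case (Suc n)
      then show ?case
        using step_bound[of "iter_seq S f x0 n"] \<alpha> unfolding step by (auto simp: S_def simp del: iter_seq.simps)
    qed (use that in simp)
    have dec: "iter_seq S f x0 (Suc n) \<le> iter_seq S f x0 n" for n
      using inv[of n] step_bound[of "iter_seq S f x0 n"] unfolding step by simp
    then show ?thesis
      using inv limit by (simp add: monoseq_Suc)
  qed
  have left: "(\<forall>n. iter_seq S f x0 n \<in> S) \<and>
      (\<forall>n. iter_seq S f x0 (Suc n) \<ge> iter_seq S f x0 n) \<and> iter_seq S f x0 \<longlonglongrightarrow> \<alpha>"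
    if "x0 \<in> S" "x0 \<le> \<alpha>" for x0
  proof -
    have inv: "iter_seq S f x0 n \<in> S \<and> iter_seq S f x0 n \<le> \<alpha>" for n
    proof (induction n)
      case (Suc n)
      then show ?case
        using step_bound[of "iter_seq S f x0 n"] \<alpha> unfolding step by (auto simp: S_def simp del: iter_seq.simps)
    qed (use that in simp)
    have inc: "iter_seq S f x0 n \<le> iter_seq S f x0 (Suc n)" for n
      using inv[of n] step_bound[of "iter_seq S f x0 n"] unfolding step by simp
    then show ?thesis
      using inv limit by (simp add: monoseq_Suc)
  qed
  show ?thesis
    using right left right_or_left sign unfolding f1_def unfolding S_def by blast
qed

end
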